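(* Let $T$ be a numerical semigroup, let $d\ge 2$, and let $S$ be the $T$-stripe GNS in $\mathbb{N}^d$, i.e. $S=\mathbb{N}^d\setminus\big(\{\mathbf{x}\in\mathbb{N}^d:0<|\mathbf{x}|<\operatorname{m}(T)\}\cup\bigcup_{i=1}^d\{h\mathbf{e}_i:h\in\operatorname{H}(T)\}\big)$. Then $\operatorname{e}(S)\ge d(\operatorname{t}(S)+1)$. In particular $S$ satisfies the generalized Wilf's conjecture, i.e. $\operatorname{e}(S)\operatorname{n}(S)\ge d\operatorname{c}(S)$.
   Context: $\mathbb{N}$ is the set of non-negative integers; $\mathbf{e}_i$ are the standard basis vectors; $|\mathbf{x}|$ is the sum of coordinates; $\le$ on $\mathbb{N}^d$ is the componentwise partial order. A GNS is a submonoid $S\subseteq\mathbb{N}^d$ with finite complement $\operatorname{H}(S)=\mathbb{N}^d\setminus S$; a numerical semigroup is the case $d=1$, and $\operatorname{m}(T)=\min(T\setminus\{0\})$. $\operatorname{e}(S)$ is the cardinality of the minimal system of generators of $S$; $\operatorname{PF}(S)=\{\mathbf{x}\in\operatorname{H}(S):\mathbf{x}+\mathbf{s}\in S\ \forall\mathbf{s}\in S\setminus\{\mathbf{0}\}\}$, $\operatorname{t}(S)=|\operatorname{PF}(S)|$; $\operatorname{n}(S)=|\{\mathbf{s}\in S:\mathbf{s}\le\mathbf{h}\text{ for some }\mathbf{h}\in\operatorname{H}(S)\}|$; $\operatorname{c}(S)=|\{\mathbf{n}\in\mathbb{N}^d:\mathbf{n}\le\mathbf{h}\text{ for some }\mathbf{h}\in\operatorname{H}(S)\}|$.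 *)

theory Defs
  imports "HOL-Analysis.Finite_Cartesian_Product"
begin

text \<open>
  The monoid \<open>\<nat>\<^sup>d\<close> is the type \<^typ>\<open>nat ^ 'd\<close> with \<open>d = CARD('d)\<close>, ordered componentwise by the
  library order on vectors. Numerical semigroups (\<open>d = 1\<close>) are sets of type \<^typ>\<open>nat set\<close>.
\<close>

definition submonoid :: "'a::comm_monoid_add set \<Rightarrow> bool" where
  "submonoid S \<longleftrightarrow> 0 \<in> S \<and> (\<forall>x\<in>S. \<forall>y\<in>S. x + y \<in> S)"

definition gaps :: "'a set \<Rightarrow> 'a set" where
  "gaps S = UNIV - S"

definition numerical_semigroup :: "nat set \<Rightarrow> bool" where
  "numerical_semigroup T \<longleftrightarrow> submonoid T \<and> finite (gaps T)"

definition gns :: "(nat ^ 'd) set \<Rightarrow> bool" where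
  "gns S \<longleftrightarrow> submonoid S \<and> finite (gaps S)"

definition multiplicity_ns :: "nat set \<Rightarrow> nat" where
  "multiplicity_ns T = (LEAST n. n \<in> T - {0})"

definition coord_sum :: "nat ^ 'd \<Rightarrow> nat" where
  "coord_sum x = (\<Sum>i\<in>UNIV. x $ i)"

definition minimal_generating_system :: "(nat ^ 'd) set \<Rightarrow> (nat ^ 'd) set \<Rightarrow> bool" where
  "minimal_generating_system S A \<longleftrightarrow>
     submonoid hull A = S \<and> (\<forall>B. B \<subset> A \<longrightarrow> submonoid hull B \<noteq> S)"

text \<open>
  The definite description is justified by \<open>ex1_minimal_generating_system\<close> below.
\<close>

definition minimal_generators :: "(nat ^ 'd) set \<Rightarrow> (nat ^ 'd) set" where
  "minimal_generators S = (THE A. minimal_generating_system S A)"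

definition embedding_dim :: "(nat ^ 'd) set \<Rightarrow> nat" where
  "embedding_dim S = card (minimal_generators S)"

definition pseudo_frobenius :: "(nat ^ 'd) set \<Rightarrow> (nat ^ 'd) set" where
  "pseudo_frobenius S = {x \<in> gaps S. \<forall>s\<in>S - {0}. x + s \<in> S}"

definition type_gns :: "(nat ^ 'd) set \<Rightarrow> nat" where
  "type_gns S = card (pseudo_frobenius S)"

definition n_gns :: "(nat ^ 'd) set \<Rightarrow> nat" where
  "n_gns S = card {s \<in> S. \<exists>h\<in>gaps S. s \<le> h}"

definition c_gns :: "(nat ^ 'd) set \<Rightarrow> nat" where
  "c_gns S = card {n. \<exists>h\<in>gaps S. n \<le> h}"

definition generalized_wilf :: "(nat ^ 'd) set \<Rightarrow> bool" where
  "generalized_wilf S \<longleftrightarrow> embedding_dim S * n_gns S \<ge> CARD('d) * c_gns S"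

text \<open>Here \<open>axis i h\<close> is the vector \<open>h \<cdot> e\<^sub>i\<close>.\<close>

definition stripe :: "nat set \<Rightarrow> (nat ^ 'd) set" where
  "stripe T = UNIV - ({x. 0 < coord_sum x \<and> coord_sum x < multiplicity_ns T}
                       \<union> (\<Union>i. {axis i h | h. h \<in> gaps T}))"


lemma coord_sum_add: "coord_sum (x + y) = coord_sum x + coord_sum y"
  by (simp add: coord_sum_def sum.distrib)

lemma coord_sum_eq_0_iff: "coord_sum x = 0 \<longleftrightarrow> x = 0"
  by (simp add: coord_sum_def vec_eq_iff)

lemma coord_sum_axis: "coord_sum (axis i h) = h"
  by (simp add: coord_sum_def axis_def)

lemma submonoid_hull: "submonoid (submonoid hull A)"
  by (rule hull_in) (auto simp: submonoid_def)

lemma ex1_minimal_generating_system: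
  fixes S :: "(nat ^ 'd) set"
  assumes S: "submonoid S"
  shows "\<exists>!A. minimal_generating_system S A"
proof -
  define M where "M = {x \<in> S - {0}. \<forall>y\<in>S - {0}. \<forall>z\<in>S - {0}. x \<noteq> y + z}"
  have sub: "M \<subseteq> A" if A: "submonoid hull A = S" for A
  proof
    fix x assume x: "x \<in> M"
    show "x \<in> A"
    proof (rule ccontr)
      assume nx: "x \<notin> A"
      have "A \<subseteq> S - {x}" using A nx hull_subset[of A submonoid] by auto
      moreover have "submonoid (S - {x})"
        unfolding submonoid_def
      proof (intro conjI ballI)
        show "0 \<in> S - {x}" using S x by (auto simp: submonoid_def M_def)
        fix y z assume yz: "y \<in> S - {x}" "z \<in> S - {x}"
        have "y + z \<noteq> x"
        proof (cases "y = 0 \<or> z = 0")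
          case True then show ?thesis using yz by auto
        next
          case False then show ?thesis using yz x by (auto simp: M_def)
        qed
        then show "y + z \<in> S - {x}" using S yz by (auto simp: submonoid_def)
      qed
      ultimately have "submonoid hull A \<subseteq> S - {x}" by (rule hull_minimal)
      then show False using A x by (auto simp: M_def)
    qed
  qed
  have mem: "x \<in> submonoid hull M" if "x \<in> S" for x
    using that
  proof (induction "coord_sum x" arbitrary: x rule: less_induct)
    case less
    show ?case
    proof (cases "x = 0 \<or> x \<in> M")
      case True
      then show ?thesis using submonoid_hull[of M] by (auto simp: submonoid_def intro: hull_inc)
    next
      case False
      then obtain y z where yz: "y \<in> S" "y \<noteq> 0" "z \<in> S" "z \<noteq> 0" "x = y + z"
        using less.prems by (auto simp: M_def)
      then have "coord_sum y > 0" "coord_sum z > 0"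
        using coord_sum_eq_0_iff by (metis gr0I)+
      then have "coord_sum y < coord_sum x" "coord_sum z < coord_sum x"
        using yz by (auto simp: coord_sum_add)
      then have "y \<in> submonoid hull M" "z \<in> submonoid hull M" using less.hyps yz by auto
      then show ?thesis using submonoid_hull[of M] yz by (auto simp: submonoid_def)
    qed
  qed
  have hM: "submonoid hull M = S"
  proof
    show "submonoid hull M \<subseteq> S" by (rule hull_minimal) (auto simp: M_def S)
    show "S \<subseteq> submonoid hull M" using mem by auto
  qed
  show ?thesis
  proof (rule ex1I[of _ M])
    show "minimal_generating_system S M"
      unfolding minimal_generating_system_def using hM sub by blast
    fix A assume "minimal_generating_system S A"
    then show "A = M" unfolding minimal_generating_system_def using hM sub by blast
  qed
qed

lemma multiplicity_ns_props:
  assumes T: "numerical_semigroup T"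
  shows "multiplicity_ns T \<in> T" "multiplicity_ns T > 0"
    and "\<And>n. n \<in> T \<Longrightarrow> n > 0 \<Longrightarrow> multiplicity_ns T \<le> n"
proof -
  have "infinite (T - {0})"
    using T finite_Diff2[of "{0}" T] infinite_UNIV_nat
    by (auto simp: numerical_semigroup_def gaps_def dest: Diff_infinite_finite)
  then obtain n where "n \<in> T - {0}" by (metis finite.emptyI ex_in_conv)
  then have "multiplicity_ns T \<in> T - {0}" unfolding multiplicity_ns_def by (rule LeastI)
  then show "multiplicity_ns T \<in> T" "multiplicity_ns T > 0" by auto
  show "multiplicity_ns T \<le> n" if "n \<in> T" "n > 0" for n
    unfolding multiplicity_ns_def using that by (intro Least_le) auto
qed

lemma gns_stripe:
  assumes T: "numerical_semigroup T"
  shows "gns (stripe T :: (nat ^ 'd) set)"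
proof -
  let ?m = "multiplicity_ns T"
  let ?S = "stripe T :: (nat ^ 'd) set"
  have mem: "x \<in> ?S \<longleftrightarrow> (x = 0 \<or> ?m \<le> coord_sum x) \<and> (\<forall>i h. x = axis i h \<longrightarrow> h \<in> T)"
    for x :: "nat ^ 'd"
    unfolding stripe_def gaps_def using coord_sum_eq_0_iff[of x] by auto
  have T0: "0 \<in> T" and Tadd: "\<And>x y. x \<in> T \<Longrightarrow> y \<in> T \<Longrightarrow> x + y \<in> T"
    using T by (auto simp: numerical_semigroup_def submonoid_def)
  have "submonoid ?S"
    unfolding submonoid_def
  proof (intro conjI ballI)
    have "h = 0" if "(0 :: nat ^ 'd) = axis i h" for i h
      using that by (metis axis_nth zero_index)
    then show "(0 :: nat ^ 'd) \<in> ?S" using T0 by (auto simp: mem)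
    fix x y :: "nat ^ 'd" assume xy: "x \<in> ?S" "y \<in> ?S"
    have "h \<in> T" if eq: "x + y = axis i h" for i h
    proof -
      have "x $ j + y $ j = (if j = i then h else 0)" for j
        using arg_cong[OF eq, of "\<lambda>v. v $ j"] by (simp add: axis_def)
      then have z: "x $ j = 0" "y $ j = 0" if "j \<noteq> i" for j
        using that by (metis add_is_0)+
      have "x = axis i (x $ i)" "y = axis i (y $ i)"
        using z by (auto simp: vec_eq_iff axis_def)
      then have "x $ i \<in> T" "y $ i \<in> T" using xy mem by blast+
      moreover have "h = x $ i + y $ i" using arg_cong[OF eq, of "\<lambda>v. v $ i"] by simp
      ultimately show ?thesis using Tadd by simp
    qed
    moreover have "x + y = 0 \<or> ?m \<le> coord_sum (x + y)"
      using xy by (auto simp: mem coord_sum_add)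
    ultimately show "x + y \<in> ?S" by (auto simp: mem)
  qed
  moreover have "finite (gaps ?S)"
  proof -
    have "finite {x :: nat ^ 'd. coord_sum x < ?m}"
    proof (rule finite_subset)
      show "{x :: nat ^ 'd. coord_sum x < ?m} \<subseteq> {x. \<forall>i. x $ i \<in> {..<?m}}"
      proof safe
        fix x :: "nat ^ 'd" and i assume "coord_sum x < ?m"
        moreover have "x $ i \<le> coord_sum x" unfolding coord_sum_def by (rule member_le_sum) auto
        ultimately show "x $ i < ?m" by simp
      qed
      have "finite ((\<lambda>f. \<chi> i. f i) ` (UNIV \<rightarrow>\<^sub>E {..<?m}) :: (nat ^ 'd) set)"
        by (intro finite_imageI finite_PiE) auto
      moreover have "{x :: nat ^ 'd. \<forall>i. x $ i \<in> {..<?m}}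
          \<subseteq> (\<lambda>f. \<chi> i. f i) ` (UNIV \<rightarrow>\<^sub>E {..<?m})"
      proof
        fix x :: "nat ^ 'd" assume "x \<in> {x. \<forall>i. x $ i \<in> {..<?m}}"
        then have "(\<lambda>i. x $ i) \<in> UNIV \<rightarrow>\<^sub>E {..<?m}" by auto
        then show "x \<in> (\<lambda>f. \<chi> i. f i) ` (UNIV \<rightarrow>\<^sub>E {..<?m})"
          by (rule rev_image_eqI) (simp add: vec_eq_iff)
      qed
      ultimately show "finite {x :: nat ^ 'd. \<forall>i. x $ i \<in> {..<?m}}" by (rule rev_finite_subset)
    qed
    moreover have "finite (\<Union>i::'d. axis i ` gaps T)"
      using T by (auto simp: numerical_semigroup_def)
    moreover have "gaps ?S \<subseteq> {x. coord_sum x < ?m} \<union> (\<Union>i. axis i ` gaps T)"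
      by (auto simp: gaps_def stripe_def)
    ultimately show ?thesis by (meson finite_UnI finite_subset)
  qed
  ultimately show ?thesis by (simp add: gns_def)
qed

end

theory Submission
  imports Defs
begin

text \<open>
  Write \<open>m\<close> for the multiplicity of \<open>T\<close> and \<open>b n\<close> for the number of \<open>x \<in> \<nat>\<^sup>d\<close> with
  \<open>|x| < n\<close>. Reducing coordinates modulo \<open>m\<close> maps \<open>PF(S)\<close> injectively into
  \<open>{x. 0 < |x| < m}\<close>, so \<open>t(S) + 1 \<le> b m\<close>. Conversely, every off-axis \<open>x\<close> with
  \<open>m \<le> |x| < 2m\<close> is a minimal generator, since nonzero elements of \<open>S\<close> have coordinate sum at
  least \<open>m\<close>, and for \<open>m \<ge> 2\<close> each axis carries at least two more: \<open>m\<close> and the least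
  element of \<open>T\<close> not divisible by \<open>m\<close>. Hence \<open>e(S) \<ge> b (2m) - b m - d(m - 2)\<close>, and the
  binomial inequality \<open>b (2m) \<ge> (d + 1) b m + d(m - 2)\<close> gives the first claim.
  Wilf's inequality follows because every gap is \<open>f - s\<close> with \<open>f \<in> PF(S)\<close> and \<open>s \<in> S\<close>,
  \<open>s \<le> f\<close>, whence \<open>c(S) \<le> (t(S) + 1) n(S)\<close>.
\<close>

section \<open>Counting vectors by coordinate sum\<close>

text \<open>Listing the index type once as \<open>ixs\<close> identifies vectors with lists of
  length d and prescribed sum, which stars and bars counts.\<close>

lemma card_coord_sum_eq:
  "finite {x :: nat ^ 'd. coord_sum x = n}"
  "card {x :: nat ^ 'd. coord_sum x = n} = (n + CARD('d) - 1) choose n"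
proof -
  obtain ixs :: "'d list" where ixs: "set ixs = UNIV" "distinct ixs"
    using finite_distinct_list[of "UNIV :: 'd set"] by auto
  have len: "length ixs = CARD('d)"
    using ixs distinct_card by metis
  have cs: "coord_sum x = sum_list (map (($) x) ixs)" for x :: "nat ^ 'd"
    using ixs by (simp add: coord_sum_def sum_list_distinct_conv_sum_set)
  let ?L = "{l. length l = CARD('d) \<and> sum_list l = n}"
  have bij: "bij_betw (\<lambda>x. map (($) x) ixs) {x :: nat ^ 'd. coord_sum x = n} ?L"
  proof (intro bij_betwI')
    show "(map (($) x) ixs = map (($) y) ixs) = (x = y)" for x y :: "nat ^ 'd"
      using ixs by (auto simp: vec_eq_iff)
    show "map (($) x) ixs \<in> ?L" if "x \<in> {x. coord_sum x = n}" for x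
      using that len cs by simp
    show "\<exists>x\<in>{x. coord_sum x = n}. l = map (($) x) ixs" if l: "l \<in> ?L" for l
    proof -
      define x :: "nat ^ 'd" where "x = (\<chi> i. the (map_of (zip ixs l) i))"
      have "map (($) x) ixs = map (the \<circ> map_of (zip ixs l)) ixs"
        by (simp add: x_def)
      also have "\<dots> = l"
        using ixs(2) l len by (intro nth_equalityI) (auto simp: map_of_zip_nth)
      finally show ?thesis
        using l cs by force
    qed
  qed
  have "?L \<subseteq> {l. set l \<subseteq> {..n} \<and> length l = CARD('d)}"
    by (auto intro: member_le_sum_list)
  then have "finite ?L"
    by (rule finite_subset) (simp add: finite_lists_length_eq)
  then show "finite {x :: nat ^ 'd. coord_sum x = n}"
    using bij_betw_finite[OF bij] by simp
  show "card {x :: nat ^ 'd. coord_sum x = n} = (n + CARD('d) - 1) choose n"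
    using bij_betw_same_card[OF bij] card_length_sum_list[of "CARD('d)" n] by simp
qed

lemma card_coord_sum_le:
  "finite {x :: nat ^ 'd. coord_sum x \<le> n}"
  "card {x :: nat ^ 'd. coord_sum x \<le> n} = (n + CARD('d)) choose CARD('d)"
proof -
  have U: "{x :: nat ^ 'd. coord_sum x \<le> n} = (\<Union>k\<le>n. {x. coord_sum x = k})"
    by auto
  show "finite {x :: nat ^ 'd. coord_sum x \<le> n}"
    unfolding U using card_coord_sum_eq(1) by blast
  \<comment> \<open>Writing d as \<open>Suc r\<close> removes the truncated \<open>- 1\<close> from
    the counts, so that the hockey-stick identity \<open>sum_choose_lower\<close> applies.\<close>
  obtain r where r: "CARD('d) = Suc r"
    using zero_less_card_finite[where 'a='d] gr0_conv_Suc by blast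
  have "card {x :: nat ^ 'd. coord_sum x \<le> n} = (\<Sum>k\<le>n. card {x :: nat ^ 'd. coord_sum x = k})"
    unfolding U using card_coord_sum_eq(1) by (intro card_UN_disjoint) auto
  also have "\<dots> = (\<Sum>k\<le>n. (r + k) choose k)"
    by (simp add: card_coord_sum_eq(2) r add.commute)
  also have "\<dots> = Suc (r + n) choose n"
    by (rule sum_choose_lower)
  also have "\<dots> = (n + CARD('d)) choose CARD('d)"
    using binomial_symmetric[of n "Suc (r + n)"] by (simp add: r add.commute)
  finally show "card {x :: nat ^ 'd. coord_sum x \<le> n} = (n + CARD('d)) choose CARD('d)" .
qed

lemma finite_coord_sum_less: "finite {x :: nat ^ 'd. coord_sum x < n}"
  by (rule finite_subset[OF _ card_coord_sum_le(1)[of n]]) auto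

section \<open>The binomial inequality\<close>

text \<open>With \<open>k = m - 1\<close> this is the inequality between \<open>b (2m)\<close> and
  \<open>b m\<close>. Induction on d works because passing to d + 1 multiplies each binomial by an
  explicit ratio.\<close>

lemma binomial_double_ge:
  assumes "d \<ge> 2" "k \<ge> 1"
  shows "(2 * k + 1 + d) choose d \<ge> (d + 1) * ((k + d) choose d) + d * (k - 1)"
  using assms(1)
proof (induction d rule: dec_induct)
  case base
  have two: "2 * (Suc (Suc n) choose 2) = Suc (Suc n) * Suc n" for n
    using Suc_times_binomial[of 1 "Suc n"] by (simp add: numeral_2_eq_2)
  obtain j where "k = Suc j" using assms(2) by (cases k) auto
  \<comment> \<open>Twice the difference of the two sides is j^2 - j + 2, so
    \<open>j \<le> j * j\<close> suffices.\<close>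
  then have "2 * ((2 * k + 1 + 2) choose 2) \<ge> 2 * (3 * ((k + 2) choose 2) + 2 * (k - 1))"
    using two[of "2 * k + 1"] two[of k] mult_le_mono1[of 1 j j]
    by (cases j) (simp_all add: algebra_simps)
  then show ?case by simp
next
  case (step d)
  let ?P = "(2 * k + 1 + d) choose d" and ?C = "(k + d) choose d"
  let ?P' = "(2 * k + 1 + Suc d) choose Suc d" and ?C' = "(k + Suc d) choose Suc d"
  have P': "Suc d * ?P' = (2 * k + 2 + d) * ?P"
    using Suc_times_binomial[of d "2 * k + 1 + d"] by simp
  have C': "Suc d * ?C' = (k + 1 + d) * ?C"
    using Suc_times_binomial[of d "k + d"] by simp
  \<comment> \<open>After multiplication by \<open>Suc d\<close>, which clears the denominators of
    the ratios, \<open>1\<close> and \<open>2\<close> compare the coefficients of \<open>?C\<close>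
    and of \<open>k - 1\<close> separately.\<close>
  have 1: "(d + 2) * (k + 1 + d) \<le> (2 * k + 2 + d) * (d + 1)"
    by (simp add: algebra_simps)
  have 2: "Suc d * Suc d \<le> (2 * k + 2 + d) * d"
  proof -
    have "Suc d * Suc d \<le> (4 + d) * d" using step(1) by (simp add: algebra_simps)
    also have "\<dots> \<le> (2 * k + 2 + d) * d" using assms(2) by (intro mult_right_mono) auto
    finally show ?thesis .
  qed
  have "Suc d * ((Suc d + 1) * ?C' + Suc d * (k - 1)) =
      (d + 2) * (Suc d * ?C') + Suc d * Suc d * (k - 1)"
    by (simp only: distrib_left mult.assoc mult.left_commute) simp
  also have "\<dots> = (d + 2) * (k + 1 + d) * ?C + Suc d * Suc d * (k - 1)"
    unfolding C' by (simp only: mult.assoc)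
  also have "\<dots> \<le> (2 * k + 2 + d) * (d + 1) * ?C + (2 * k + 2 + d) * d * (k - 1)"
    by (intro add_mono mult_right_mono 1 2) auto
  also have "\<dots> = (2 * k + 2 + d) * ((d + 1) * ?C + d * (k - 1))"
    by (simp only: distrib_left[of "2 * k + 2 + d" "(d + 1) * ?C"] mult.assoc)
  also have "\<dots> \<le> (2 * k + 2 + d) * ?P"
    using step.IH by (intro mult_left_mono) auto
  also have "\<dots> = Suc d * ?P'" by (simp only: P')
  finally show ?case by (simp only: mult_le_cancel1)
qed

section \<open>Minimal generators as irreducible elements\<close>

lemma minimal_generating_system_minimal_generators:
  "submonoid S \<Longrightarrow> minimal_generating_system S (minimal_generators S)"
  unfolding minimal_generators_def by (rule theI') (rule ex1_minimal_generating_system)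

lemma minimal_generators_hull: "submonoid S \<Longrightarrow> submonoid hull (minimal_generators S) = S"
  using minimal_generating_system_minimal_generators
  by (auto simp: minimal_generating_system_def)

text \<open>Removing an irreducible element x from S leaves a submonoid, so generators avoiding x
  never produce x.\<close>

lemma irreducible_in_minimal_generators:
  assumes S: "submonoid S" and x: "x \<in> S" "x \<noteq> 0"
    and irred: "\<And>y z. y \<in> S \<Longrightarrow> z \<in> S \<Longrightarrow> y \<noteq> 0 \<Longrightarrow> z \<noteq> 0 \<Longrightarrow> x \<noteq> y + z"
  shows "x \<in> minimal_generators S"
proof (rule ccontr)
  assume "x \<notin> minimal_generators S"
  then have "minimal_generators S \<subseteq> S - {x}"
    using minimal_generators_hull[OF S] hull_subset[of "minimal_generators S" submonoid] by auto
  moreover have "submonoid (S - {x})"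
    using S x irred unfolding submonoid_def
    by (metis DiffE DiffI add.left_neutral add.right_neutral singletonD singletonI)
  ultimately have "submonoid hull (minimal_generators S) \<subseteq> S - {x}"
    by (rule hull_minimal)
  then show False
    using minimal_generators_hull[OF S] x by auto
qed

text \<open>Coordinate sums are additive and nonnegative, so no summand of x exceeds x in coordinate
  sum.\<close>

lemma submonoid_hull_coord_sum_less:
  assumes "x \<in> submonoid hull A" "coord_sum x < n"
  shows "x \<in> submonoid hull {a \<in> A. coord_sum a < n}"
proof -
  let ?Q = "{x. coord_sum x < n \<longrightarrow> x \<in> submonoid hull {a \<in> A. coord_sum a < n}}"
  have "submonoid hull A \<subseteq> ?Q"
  proof (rule hull_minimal)
    show "A \<subseteq> ?Q" by (auto intro: hull_inc)
    show "submonoid ?Q"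
      using submonoid_hull[of "{a \<in> A. coord_sum a < n}"]
      unfolding submonoid_def by (auto simp: coord_sum_add)
  qed
  then show ?thesis using assms by auto
qed

text \<open>If x = y + z, both summands have smaller coordinate sum and are generated without x;
  then x is redundant, against minimality.\<close>

lemma minimal_generators_irreducible:
  assumes S: "submonoid S" and x: "x \<in> minimal_generators S"
    and yz: "y \<in> S" "z \<in> S" "y \<noteq> 0" "z \<noteq> 0"
  shows "x \<noteq> y + z"
proof
  assume eq: "x = y + z"
  let ?A = "minimal_generators S"
  let ?B = "{a \<in> ?A. coord_sum a < coord_sum x}"
  have "coord_sum y > 0" "coord_sum z > 0"
    using yz by (simp_all add: coord_sum_eq_0_iff zero_less_iff_neq_zero)
  then have "y \<in> submonoid hull ?B" "z \<in> submonoid hull ?B"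
    using yz eq minimal_generators_hull[OF S]
    by (auto intro!: submonoid_hull_coord_sum_less simp: coord_sum_add)
  moreover have "submonoid hull ?B \<subseteq> submonoid hull (?A - {x})"
    by (intro hull_mono) auto
  ultimately have "x \<in> submonoid hull (?A - {x})"
    using submonoid_hull[of "?A - {x}"] eq unfolding submonoid_def by blast
  then have "submonoid hull (?A - {x}) = submonoid hull ?A"
    using hull_redundant[of x submonoid "?A - {x}"] x by (simp add: insert_absorb)
  moreover have "?A - {x} \<subset> ?A" using x by auto
  ultimately show False
    using minimal_generating_system_minimal_generators[OF S] minimal_generators_hull[OF S]
    by (auto simp: minimal_generating_system_def)
qed

lemma coord_sum_split:
  fixes x :: "nat ^ 'd"
  assumes "k \<le> coord_sum x"
  shows "\<exists>y z. x = y + z \<and> coord_sum y = k"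
  using assms
proof (induction k)
  case 0
  show ?case by (intro exI[of _ 0] exI[of _ x]) (simp add: coord_sum_eq_0_iff)
next
  case (Suc k)
  then obtain y z where yz: "x = y + z" "coord_sum y = k" by auto
  then have "z \<noteq> 0" using Suc.prems coord_sum_eq_0_iff[of z] by (auto simp: coord_sum_add)
  then obtain i where i: "z $ i > 0" by (auto simp: vec_eq_iff)
  have "x = (y + axis i 1) + (\<chi> j. if j = i then z $ i - 1 else z $ j)"
    using i by (auto simp: yz(1) vec_eq_iff axis_def)
  moreover have "coord_sum (y + axis i 1) = Suc k"
    by (simp add: coord_sum_add coord_sum_axis yz)
  ultimately show ?case by blast
qed

text \<open>A vector of large coordinate sum splits into two vectors too large to be gaps, hence is
  reducible. Finiteness makes cardinality bounds on \<open>embedding_dim\<close> meaningful.\<close>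

lemma finite_minimal_generators:
  assumes S: "gns S"
  shows "finite (minimal_generators S)"
proof -
  have sub: "submonoid S" and fin: "finite (gaps S)" using S by (auto simp: gns_def)
  obtain n where n: "\<And>x. x \<in> gaps S \<Longrightarrow> coord_sum x < n"
    using finite_nat_set_iff_bounded[of "coord_sum ` gaps S"] fin by auto
  \<comment> \<open>\<open>Suc n\<close> instead of \<open>n\<close> keeps both halves nonzero even
    when \<open>n = 0\<close>.\<close>
  have "minimal_generators S \<subseteq> {x. coord_sum x < 2 * Suc n}"
  proof (rule ccontr)
    assume "\<not> ?thesis"
    then obtain x where x: "x \<in> minimal_generators S" "coord_sum x \<ge> 2 * Suc n" by force
    obtain y z where yz: "x = y + z" "coord_sum y = Suc n"
      using coord_sum_split[of "Suc n" x] x(2) by auto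
    then have z: "coord_sum z \<ge> Suc n" using x(2) by (simp add: coord_sum_add)
    have "y \<in> S" "z \<in> S" using n[of y] n[of z] yz z by (auto simp: gaps_def)
    moreover have "y \<noteq> 0" "z \<noteq> 0"
      using yz z coord_sum_eq_0_iff[of y] coord_sum_eq_0_iff[of z] by auto
    ultimately show False using minimal_generators_irreducible[OF sub x(1)] yz(1) by blast
  qed
  then show ?thesis using finite_coord_sum_less finite_subset by blast
qed

section \<open>Gaps below pseudo-Frobenius elements\<close>

text \<open>Among the finitely many gaps of the form x + s, one of largest coordinate sum is
  pseudo-Frobenius: adding a nonzero element of S keeps the form but increases the sum.\<close>

lemma gap_plus_pseudo_frobenius:
  assumes S: "gns S" and x: "x \<in> gaps S"
  shows "\<exists>s\<in>S. x + s \<in> pseudo_frobenius S"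
proof -
  have S0: "0 \<in> S" and Sadd: "\<And>x y. x \<in> S \<Longrightarrow> y \<in> S \<Longrightarrow> x + y \<in> S" and fin: "finite (gaps S)"
    using S by (auto simp: gns_def submonoid_def)
  let ?G = "{g \<in> gaps S. \<exists>s\<in>S. g = x + s}"
  have "finite ?G" "x \<in> ?G" using fin x S0 by (auto intro!: bexI[of _ 0])
  then obtain g where g: "g \<in> ?G" "\<And>h. h \<in> ?G \<Longrightarrow> coord_sum h \<le> coord_sum g"
    using arg_min_if_finite[of ?G "\<lambda>g. - int (coord_sum g)"] by (metis (no_types, lifting)
      empty_iff neg_less_iff_less not_less of_nat_less_iff)
  then obtain s where s: "s \<in> S" "g = x + s" by auto
  have "g + t \<in> S" if t: "t \<in> S" "t \<noteq> 0" for t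
  proof (rule ccontr)
    assume "g + t \<notin> S"
    then have "g + t \<in> ?G" using s t Sadd by (auto simp: gaps_def add.assoc)
    then show False using g(2)[of "g + t"] t(2) by (simp add: coord_sum_add coord_sum_eq_0_iff)
  qed
  then have "g \<in> pseudo_frobenius S" using g(1) by (auto simp: pseudo_frobenius_def)
  then show ?thesis using s by auto
qed

text \<open>The map (f, s) to f - s covers the gaps, giving the factor t(S); the extra 1 accounts
  for the elements of S below a gap.\<close>

lemma c_gns_le:
  assumes S: "gns S"
  shows "c_gns S \<le> (type_gns S + 1) * n_gns S"
proof -
  have fin: "finite (gaps S)" using S by (simp add: gns_def)
  let ?N = "{s \<in> S. \<exists>h\<in>gaps S. s \<le> h}" and ?F = "pseudo_frobenius S"
  have "finite ?F" using fin by (rule finite_subset[rotated]) (auto simp: pseudo_frobenius_def)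
  have le: "coord_sum x \<le> coord_sum y" if "x \<le> y" for x y :: "nat ^ 'd"
    using that by (auto simp: coord_sum_def less_eq_vec_def intro: sum_mono)
  obtain n where n: "\<And>x. x \<in> gaps S \<Longrightarrow> coord_sum x < n"
    using finite_nat_set_iff_bounded[of "coord_sum ` gaps S"] fin by auto
  have finN: "finite ?N"
    by (rule finite_subset[OF _ finite_coord_sum_less[of n]]) (use le n in force)
  have gaps: "gaps S \<subseteq> (\<lambda>(f, s). f - s) ` (?F \<times> ?N)"
  proof
    fix x assume "x \<in> gaps S"
    then obtain s where s: "s \<in> S" "x + s \<in> ?F" using gap_plus_pseudo_frobenius[OF S] by blast
    moreover have "s \<le> x + s" by (simp add: less_eq_vec_def)
    ultimately have "s \<in> ?N" by (auto simp: pseudo_frobenius_def)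
    moreover have "x = (x + s) - s" by (simp add: vec_eq_iff)
    ultimately show "x \<in> (\<lambda>(f, s). f - s) ` (?F \<times> ?N)" using s by force
  qed
  have "card (gaps S) \<le> card (?F \<times> ?N)"
    using surj_card_le[OF _ gaps] \<open>finite ?F\<close> finN by blast
  moreover have "{n. \<exists>h\<in>gaps S. n \<le> h} = gaps S \<union> ?N" by (auto simp: gaps_def)
  then have "c_gns S \<le> card (gaps S) + card ?N"
    unfolding c_gns_def using card_Un_le[of "gaps S" ?N] by (simp only:)
  ultimately have "c_gns S \<le> card ?F * card ?N + card ?N"
    unfolding card_cartesian_product by linarith
  then show ?thesis unfolding type_gns_def n_gns_def by (simp only: distrib_right mult_1)
qed

section \<open>The stripe along the coordinate axes\<close>

lemma stripe_iff:
  "x \<in> stripe T \<longleftrightarrow>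
    (x = 0 \<or> multiplicity_ns T \<le> coord_sum x) \<and> (\<forall>i h. x = axis i h \<longrightarrow> h \<in> T)"
  unfolding stripe_def gaps_def using coord_sum_eq_0_iff[of x] by auto

lemma axis_in_stripe_iff:
  assumes T: "numerical_semigroup T"
  shows "axis i h \<in> stripe T \<longleftrightarrow> h \<in> T"
proof -
  have "0 \<in> T" using T by (auto simp: numerical_semigroup_def submonoid_def)
  then show ?thesis
    using multiplicity_ns_props(3)[OF T, of h]
    by (auto simp: stripe_iff coord_sum_axis axis_eq_axis axis_eq_0_iff)
qed

lemma mult_in_numerical_semigroup:
  assumes T: "numerical_semigroup T" and "t \<in> T"
  shows "t * q \<in> T"
  using assms by (induction q) (auto simp: numerical_semigroup_def submonoid_def)

lemma add_axis: "axis i (a + b) = axis i a + (axis i b :: nat ^ 'd)"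
  by (simp add: vec_eq_iff axis_def)

text \<open>Natural numbers do not cancel, so summands of an axis vector lie on the same
  axis.\<close>

lemma axis_eq_add_iff:
  "axis i h = y + (z :: nat ^ 'd) \<longleftrightarrow> (\<exists>a b. y = axis i a \<and> z = axis i b \<and> h = a + b)"
proof
  assume eq: "axis i h = y + z"
  have h: "y $ j + z $ j = (if j = i then h else 0)" for j
    using arg_cong[OF eq, of "\<lambda>v. v $ j"] by (simp add: axis_def)
  then have "y = axis i (y $ i)" "z = axis i (z $ i)"
    by (auto simp: vec_eq_iff axis_def) (metis add_is_0)+
  moreover have "h = y $ i + z $ i" using h[of i] by simp
  ultimately show "\<exists>a b. y = axis i a \<and> z = axis i b \<and> h = a + b" by blast
qed (auto simp: add_axis)

section \<open>Upper bound for the type\<close>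

text \<open>The reduction \<open>r\<close> fixes vectors of coordinate sum below m and moves axis
  gaps along their axis. The added 1 counts the zero vector, which the image of \<open>r\<close>
  misses.\<close>

lemma type_stripe_le:
  assumes T: "numerical_semigroup T"
  shows "type_gns (stripe T :: (nat ^ 'd) set) + 1
    \<le> (multiplicity_ns T - 1 + CARD('d)) choose CARD('d)"
proof -
  define m where "m = multiplicity_ns T"
  let ?S = "stripe T :: (nat ^ 'd) set"
  have m: "m \<in> T" "m > 0" using multiplicity_ns_props[OF T] by (auto simp: m_def)
  define r :: "nat ^ 'd \<Rightarrow> nat ^ 'd" where "r x = (\<chi> i. x $ i mod m)" for x
  have gap: "0 < coord_sum x \<and> coord_sum x < m \<or> (\<exists>i h. x = axis i h \<and> h \<notin> T)"
    if "x \<in> gaps ?S" for x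
    using that by (auto simp: stripe_def gaps_def m_def)
  have small: "r x = x" if "coord_sum x < m" for x
  proof -
    have "x $ i \<le> coord_sum x" for i unfolding coord_sum_def by (rule member_le_sum) auto
    then show ?thesis using that by (auto simp: r_def vec_eq_iff intro!: mod_less intro: le_less_trans)
  qed
  have axis: "r (axis i h) = axis i (h mod m)" for i h
    by (simp add: r_def vec_eq_iff axis_def)
  \<comment> \<open>Multiples of m lie in T, so a gap of T has nonzero residue; hence
    \<open>r\<close> neither sends an axis gap to 0 nor forgets its axis.\<close>
  have mod: "h mod m \<noteq> 0" if "h \<notin> T" for h
    using that mult_in_numerical_semigroup[OF T m(1)] by (metis mod_0_imp_dvd dvdE)
  have "r ` pseudo_frobenius ?S \<subseteq> {x. coord_sum x \<le> m - 1} - {0}"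
  proof
    fix y assume "y \<in> r ` pseudo_frobenius ?S"
    then obtain x where x: "x \<in> gaps ?S" "y = r x" by (auto simp: pseudo_frobenius_def)
    from gap[OF x(1)] show "y \<in> {x. coord_sum x \<le> m - 1} - {0}"
    proof
      assume "0 < coord_sum x \<and> coord_sum x < m"
      then show ?thesis using x small by (auto simp flip: coord_sum_eq_0_iff)
    next
      assume "\<exists>i h. x = axis i h \<and> h \<notin> T"
      then obtain i h where h: "x = axis i h" "h \<notin> T" by blast
      have "h mod m < m" using m by simp
      then show ?thesis using h mod[OF h(2)] x axis by (auto simp: coord_sum_axis axis_eq_0_iff)
    qed
  qed
  moreover have "inj_on r (pseudo_frobenius ?S)"
  proof (rule inj_onI)
    fix x y assume xy: "x \<in> pseudo_frobenius ?S" "y \<in> pseudo_frobenius ?S" "r x = r y"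
    then have gxy: "x \<in> gaps ?S" "y \<in> gaps ?S" by (auto simp: pseudo_frobenius_def)
    \<comment> \<open>Congruent entries on one axis differ by a multiple of m; adding it to the
      smaller vector would put the larger one, a gap, into S.\<close>
    have ne: "\<not> h < h'"
      if hh': "axis i h \<in> pseudo_frobenius ?S" "axis i h' \<in> pseudo_frobenius ?S" "h mod m = h' mod m"
      for i h h'
    proof
      assume "h < h'"
      then obtain q where q: "h' = h + m * q" "q > 0"
        using hh'(3) by (metis less_imp_le mod_eq_nat1E nat_0_less_mult_iff add.right_neutral
          gr0I mult_0_right order_less_irrefl)
      have "axis i (m * q) \<in> ?S - {0}"
        using q m mult_in_numerical_semigroup[OF T m(1)]
        by (auto simp: axis_eq_0_iff axis_in_stripe_iff[OF T])
      then have "axis i h + axis i (m * q) \<in> ?S" using hh'(1) by (auto simp: pseudo_frobenius_def)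
      then show False using hh'(2) by (auto simp: q add_axis pseudo_frobenius_def gaps_def)
    qed
    have "x = y \<or> (\<exists>i h h'. x = axis i h \<and> y = axis i h' \<and> h mod m = h' mod m)"
      using gap[OF gxy(1)] gap[OF gxy(2)]
    proof (elim disjE exE conjE)
      assume "coord_sum x < m" "coord_sum y < m"
      then show ?thesis using small xy(3) by auto
    next
      fix i h assume "coord_sum x < m" "y = axis i h"
      then have "x = axis i (h mod m)" using small xy(3) axis by auto
      then show ?thesis using \<open>y = _\<close> by (metis mod_mod_trivial)
    next
      fix i h assume "coord_sum y < m" "x = axis i h"
      then have "y = axis i (h mod m)" using small xy(3) axis by auto
      then show ?thesis using \<open>x = _\<close> by (metis mod_mod_trivial)
    next
      fix i j h h' assume "x = axis i h" "h \<notin> T" "y = axis j h'"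
      then show ?thesis using xy(3) mod[of h] by (auto simp: axis axis_eq_axis)
    qed
    then show "x = y"
    proof
      assume "\<exists>i h h'. x = axis i h \<and> y = axis i h' \<and> h mod m = h' mod m"
      then show ?thesis using ne xy(1,2) by (metis linorder_neqE_nat)
    qed
  qed
  ultimately have "card (pseudo_frobenius ?S) \<le> card ({x :: nat ^ 'd. coord_sum x \<le> m - 1} - {0})"
    using card_inj_on_le card_coord_sum_le(1) by blast
  also have "\<dots> = card {x :: nat ^ 'd. coord_sum x \<le> m - 1} - 1"
    using coord_sum_eq_0_iff[of "0 :: nat ^ 'd"] by (subst card_Diff_singleton) auto
  \<comment> \<open>The binomial is positive, so the truncated \<open>- 1\<close> can be moved
    across.\<close>
  finally have "card (pseudo_frobenius ?S) + 1 \<le> card {x :: nat ^ 'd. coord_sum x \<le> m - 1}"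
    using zero_less_binomial[of "CARD('d)" "m - 1 + CARD('d)"]
    by (simp add: card_coord_sum_le(2) del: zero_less_binomial_iff)
  then show ?thesis by (simp add: card_coord_sum_le(2) type_gns_def m_def)
qed

section \<open>Lower bound for the embedding dimension\<close>

lemma stripe_generator_of_coord_sum_less:
  assumes T: "numerical_semigroup T"
    and x: "(x :: nat ^ 'd) \<in> stripe T" "x \<noteq> 0" "coord_sum x < 2 * multiplicity_ns T"
  shows "x \<in> minimal_generators (stripe T)"
proof (rule irreducible_in_minimal_generators)
  show "submonoid (stripe T :: (nat ^ 'd) set)" using gns_stripe[OF T, where 'd='d] by (simp add: gns_def)
  show "x \<noteq> y + z" if "y \<in> stripe T" "z \<in> stripe T" "y \<noteq> 0" "z \<noteq> 0" for y z
    using that x(3) by (auto simp: stripe_iff coord_sum_add)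
qed (use x in auto)

text \<open>Summands of \<open>axis i w\<close> come from smaller elements of T, which are multiples
  of m; their sum could not be w.\<close>

lemma stripe_axis_generator:
  assumes T: "numerical_semigroup T" and w: "w \<in> T" "\<not> m dvd w"
    and least: "\<And>t. t \<in> T \<Longrightarrow> t < w \<Longrightarrow> m dvd t"
  shows "(axis i w :: nat ^ 'd) \<in> minimal_generators (stripe T)"
proof (rule irreducible_in_minimal_generators)
  show "submonoid (stripe T :: (nat ^ 'd) set)" using gns_stripe[OF T, where 'd='d] by (simp add: gns_def)
  show "axis i w \<in> stripe T" using w by (simp add: axis_in_stripe_iff[OF T])
  show "axis i w \<noteq> 0" using w by (metis axis_eq_0_iff dvd_0_right)
  show "axis i w \<noteq> y + z" if yz: "y \<in> stripe T" "z \<in> stripe T" "y \<noteq> 0" "z \<noteq> 0" for y z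
  proof
    assume "axis i w = y + z"
    then obtain a b where ab: "y = axis i a" "z = axis i b" "w = a + b"
      by (auto simp: axis_eq_add_iff)
    then have "a \<in> T" "b \<in> T" "a \<noteq> 0" "b \<noteq> 0"
      using yz by (auto simp: axis_eq_0_iff axis_in_stripe_iff[OF T])
    then have "m dvd a" "m dvd b" using ab least by auto
    then show False using w ab by simp
  qed
qed

text \<open>Distinct axes meet only in the origin, which \<open>0 \<notin> H\<close>
  excludes.\<close>

lemma card_axes:
  fixes H :: "nat set"
  assumes "0 \<notin> H"
  shows "card (\<Union>i::'d::finite. axis i ` H) = CARD('d) * card H"
proof -
  have "(\<Union>i::'d. axis i ` H) = (\<lambda>(i, h). axis i h) ` (UNIV \<times> H)" by auto
  moreover have "inj_on (\<lambda>(i :: 'd, h). axis i h) (UNIV \<times> H)"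
    using assms by (auto simp: inj_on_def axis_eq_axis)
  ultimately show ?thesis by (simp add: card_image card_cartesian_product)
qed

text \<open>This is the bound on e(S) with \<open>k = m - 1\<close>, written additively to avoid
  truncated subtraction.\<close>

lemma embedding_dim_stripe_ge:
  assumes T: "numerical_semigroup T" and m2: "multiplicity_ns T = k + 1" "k \<ge> 1"
  shows "(2 * k + 1 + CARD('d)) choose CARD('d)
    \<le> embedding_dim (stripe T :: (nat ^ 'd) set) + CARD('d) * (k - 1)
      + ((k + CARD('d)) choose CARD('d))"
proof -
  let ?S = "stripe T :: (nat ^ 'd) set"
  define m where "m = multiplicity_ns T"
  have m: "m \<in> T" "m = k + 1" using multiplicity_ns_props(1)[OF T] m2 by (auto simp: m_def)
  \<comment> \<open>Otherwise all numbers \<open>m * q + 1\<close> would be gaps, since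
    \<open>m \<ge> 2\<close>, contradicting finiteness.\<close>
  have "\<exists>t. t \<in> T \<and> \<not> m dvd t"
  proof (rule ccontr)
    assume *: "\<not> ?thesis"
    have "\<not> m dvd m * q + 1" for q
      unfolding dvd_add_right_iff[OF dvd_triv_left] using m m2(2) by simp
    then have "m * q + 1 \<in> gaps T" for q
      using * by (auto simp: gaps_def)
    then have "range (\<lambda>q. m * q + 1) \<subseteq> gaps T" by auto
    moreover have "inj (\<lambda>q. m * q + 1)" unfolding inj_def using m(2)
      by (metis add_right_cancel mult_cancel1 add_is_0 one_neq_zero)
    ultimately show False
      using T by (meson finite_subset finite_imageD infinite_UNIV_nat numerical_semigroup_def)
  qed
  then obtain w where w: "w \<in> T" "\<not> m dvd w" "\<And>t. t \<in> T \<Longrightarrow> t < w \<Longrightarrow> m dvd t"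
    using exists_least_iff[of "\<lambda>t. t \<in> T \<and> \<not> m dvd t"] by blast
  let ?B = "\<lambda>n. {x :: nat ^ 'd. coord_sum x \<le> n}"
  let ?A = "\<lambda>H. (\<Union>i::'d. axis i ` H)"
  \<comment> \<open>The off-axis vectors with m \<le> |x| < 2m: on an axis, the entry equals the
    coordinate sum, so exactly these entries are removed.\<close>
  let ?O = "?B (2 * k + 1) - ?B k - ?A {m..<2 * m}"
  have off: "axis i h \<notin> ?O" for i h
  proof
    assume *: "axis i h \<in> ?O"
    then have "h \<in> {m..<2 * m}" using m by (simp add: coord_sum_axis)
    with * show False by blast
  qed
  have O: "?O \<subseteq> minimal_generators ?S"
  proof
    fix x assume x: "x \<in> ?O"
    have "x \<noteq> axis i h" for i h
      using x off by blast
    then show "x \<in> minimal_generators ?S"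
      using x m m2 coord_sum_eq_0_iff[of x]
      by (intro stripe_generator_of_coord_sum_less T) (auto simp: stripe_iff)
  qed
  have A: "?A {m, w} \<subseteq> minimal_generators ?S"
  proof -
    have "axis i m \<in> minimal_generators ?S" for i
      using m m2 by (intro stripe_generator_of_coord_sum_less T)
        (auto simp: coord_sum_axis axis_eq_0_iff axis_in_stripe_iff[OF T])
    then show ?thesis using stripe_axis_generator[OF T w] by auto
  qed
  have disj: "?O \<inter> ?A {m, w} = {}"
    using off by blast
  have fin: "finite (?B n)" for n by (rule card_coord_sum_le)
  have "w \<noteq> 0" "w \<noteq> m" using w(2) by (metis dvd_0_right, metis dvd_refl)
  then have "0 \<notin> {m, w}" "card {m, w} = 2" using m(2) by auto
  then have "card (?A {m, w}) = CARD('d) * 2" using card_axes[of "{m, w}", where 'd='d] by simp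
  moreover have "card (?A {m..<2 * m}) = CARD('d) * m"
    using card_axes[of "{m..<2 * m}", where 'd='d] m by simp
  then have "card (?B (2 * k + 1)) - card (?B k) - CARD('d) * m \<le> card ?O"
    using diff_card_le_card_Diff[of "?A {m..<2 * m}" "?B (2 * k + 1) - ?B k"]
      diff_card_le_card_Diff[of "?B k" "?B (2 * k + 1)"] fin by simp
  moreover have "card ?O + card (?A {m, w}) \<le> embedding_dim ?S"
  proof -
    have "card ?O + card (?A {m, w}) = card (?O \<union> ?A {m, w})"
      using disj fin by (intro card_Un_disjoint[symmetric]) auto
    also have "\<dots> \<le> card (minimal_generators ?S)"
      using O A finite_minimal_generators[OF gns_stripe[OF T]] by (intro card_mono) auto
    finally show ?thesis by (simp add: embedding_dim_def)
  qed
  \<comment> \<open>Each axis loses m vectors and regains the two generators from m and w, a net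
    loss of \<open>k - 1\<close>.\<close>
  moreover have "CARD('d) * m = CARD('d) * (k - 1) + CARD('d) * 2"
    using m m2 by (cases k) (simp_all add: algebra_simps)
  ultimately show ?thesis by (simp add: card_coord_sum_le(2))
qed

theorem theorem3p10:
  fixes T :: "nat set" and S :: "(nat ^ 'd) set"
  assumes "numerical_semigroup T"
    and "CARD('d) \<ge> 2"
    and "S = stripe T"
  shows "embedding_dim S \<ge> CARD('d) * (type_gns S + 1) \<and> generalized_wilf S"
proof -
  note T = assms(1)
  let ?d = "CARD('d)"
  have S: "gns S" unfolding assms(3) by (rule gns_stripe[OF T])
  obtain k where k: "multiplicity_ns T = k + 1"
    using multiplicity_ns_props(2)[OF T] by (metis Suc_eq_plus1 gr0_implies_Suc)
  have t: "type_gns S + 1 \<le> (k + ?d) choose ?d"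
    using type_stripe_le[OF T, where 'd='d] k assms(3) by simp
  have main: "?d * (type_gns S + 1) \<le> embedding_dim S"
  \<comment> \<open>For \<open>k = 0\<close> the multiplicity is 1, outside the range of the
    binomial inequality. The type is then 0, and the d unit vectors suffice.\<close>
  proof (cases "k = 0")
    case True
    have "1 \<in> T" using k True multiplicity_ns_props(1)[OF T] by simp
    then have "(\<Union>i::'d. axis i ` {1}) \<subseteq> minimal_generators S"
      using k True assms(3) by (auto intro!: stripe_generator_of_coord_sum_less T
        simp: coord_sum_axis axis_eq_0_iff axis_in_stripe_iff[OF T])
    then have "card (\<Union>i::'d. axis i ` {1 :: nat}) \<le> embedding_dim S"
      unfolding embedding_dim_def by (intro card_mono finite_minimal_generators S)
    then have "?d \<le> embedding_dim S" using card_axes[of "{1}", where 'd='d] by simp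
    moreover have "type_gns S = 0" using t True by simp
    ultimately show ?thesis by simp
  next
    case False
    have "?d * (type_gns S + 1) \<le> ?d * ((k + ?d) choose ?d)"
      using t by (intro mult_left_mono) auto
    \<comment> \<open>Of the d + 1 copies of \<open>b m\<close> in the binomial inequality, one pays
      for the vectors with |x| < m and d remain; the terms \<open>d * (k - 1)\<close>
      cancel.\<close>
    also have "\<dots> \<le> embedding_dim S"
      using binomial_double_ge[OF assms(2), of k] embedding_dim_stripe_ge[OF T k, where 'd='d]
        False assms(3) by simp
    finally show ?thesis .
  qed
  have "?d * c_gns S \<le> ?d * (type_gns S + 1) * n_gns S"
    using c_gns_le[OF S] by (metis mult.assoc mult_le_mono2)
  also have "\<dots> \<le> embedding_dim S * n_gns S"
    using main by (rule mult_right_mono) simp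
  finally show ?thesis using main by (simp add: generalized_wilf_def)
qed

end
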